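(* Let $q,z\in\mathbb{C}$ with $0<|q|<1$ and $0<|z|<1$. Then the sequences $$\alpha_n=\frac{z^{-n}q^{\binom{n}{2}}(1-q^{2n+1})}{1-z}\quad(n\in\mathbb{Z}),\qquad \beta_n=\frac{(-z)_n(-1/z)_n}{(q)_{2n}}\quad(n\ge 0)$$ form an asymmetric bilateral Bailey pair with $a=1$ and $\lambda=1$; that is, for every integer $n\ge 0$, $$\beta_n=\sum_{k=-n-1}^{n}\frac{\alpha_k}{(q)_{n-k}(q)_{n+k+1}}.$$
   Context: For $n\ge 0$, $(a)_n=(a;q)_n=\prod_{j=1}^{n}(1-aq^{j-1})$, with $(a)_0=1$. For $m\in\mathbb{Z}$, $\binom{m}{2}=m(m-1)/2$. A pair of sequences $(\alpha_n)_{n\in\mathbb{Z}}$, $(\beta_n)_{n\ge 0}$ is an asymmetric bilateral Bailey pair with $a=1$, $\lambda=1$ if $\beta_n=\sum_{k=-n-1}^{n}\alpha_k/\big((q)_{n-k}(q)_{n+k+1}\big)$ for all $n\ge 0$. *)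

theory Defs
  imports Complex_Main
begin

definition qpoch :: "complex \<Rightarrow> complex \<Rightarrow> nat \<Rightarrow> complex" where
  "qpoch a q n = (\<Prod>j=1..n. 1 - a * q ^ (j - 1))"

text \<open>The quotient is exact, since \<open>m * (m - 1)\<close> is always even.\<close>

definition binom2 :: "int \<Rightarrow> int" where
  "binom2 m = m * (m - 1) div 2"

text \<open>
  Only the case \<open>a = 1\<close>, \<open>\<lambda> = 1\<close> of an asymmetric bilateral Bailey pair is defined.
  For \<open>k\<close> in the range of summation \<open>n - k\<close> and \<open>n + k + 1\<close> are nonnegative,
  so \<^const>\<open>nat\<close> does not truncate.
\<close>

definition asym_bilateral_bailey_pair ::
    "complex \<Rightarrow> (int \<Rightarrow> complex) \<Rightarrow> (nat \<Rightarrow> complex) \<Rightarrow> bool" where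
  "asym_bilateral_bailey_pair q \<alpha> \<beta> \<longleftrightarrow>
     (\<forall>n::nat. \<beta> n =
       (\<Sum>k = - int n - 1..int n.
          \<alpha> k / (qpoch q q (nat (int n - k)) * qpoch q q (nat (int n + k + 1)))))"

end

(* With j = n + k + 1 the factor 1 - q^(2k+1) splits the sum into two instances of the finite
   q-binomial theorem with 2n + 1 factors, at x = q^(-n-1)/z and at x q^2. The two products
   share all but two factors each, and the difference of the remaining factors is
   (1 - 1/z^2) (1 - q^(-2n-1)). *)
theory Submission
  imports Defs
begin

lemma qpoch_0 [simp]: "qpoch a q 0 = 1"
  by (simp add: qpoch_def)

lemma qpoch_Suc: "qpoch a q (Suc n) = qpoch a q n * (1 - a * q ^ n)"
  by (simp add: qpoch_def)

lemma qpoch_add: "qpoch a q (m + n) = qpoch a q m * qpoch (a * q ^ m) q n"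
  by (induction n) (simp_all add: qpoch_Suc power_add mult.assoc)

lemma qpoch_Suc_left: "qpoch a q (Suc n) = (1 - a) * qpoch (a * q) q n"
  using qpoch_add[of a q 1 n] by (simp add: qpoch_Suc)

lemma qpoch_q_nonzero:
  assumes "norm q < 1"
  shows "qpoch q q n \<noteq> 0"
proof (induction n)
  case (Suc n)
  have "norm (q ^ Suc n) < 1"
    using power_Suc_less_one[of "norm q" n] assms by (cases "q = 0") (auto simp: norm_power norm_mult)
  then have "q ^ Suc n \<noteq> 1" by (metis norm_one less_irrefl)
  with Suc show ?case by (simp add: qpoch_Suc)
qed simp

lemma Suc_choose_2: "Suc j choose 2 = j + (j choose 2)"
  by (simp add: numeral_2_eq_2)

lemma two_times_choose_2: "2 * int (j choose 2) = int j * (int j - 1)"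
  by (induction j) (simp_all add: Suc_choose_2 algebra_simps)

text \<open>The cross term \<open>- j * m\<close> is the only coupling between \<open>j\<close> and
  \<open>m\<close>. In a power of \<open>q\<close> it contributes a geometric factor in
  \<open>j\<close>, leaving \<open>j choose 2\<close> as in the q-binomial theorem.\<close>

lemma binom2_diff:
  "binom2 (int j - int m) = int (j choose 2) - int j * int m + int (Suc m choose 2)"
proof -
  have "2 * binom2 (int j - int m) = (int j - int m) * (int j - int m - 1)"
    unfolding binom2_def by (rule dvd_mult_div_cancel) auto
  also have "\<dots> = 2 * (int (j choose 2) - int j * int m + int (Suc m choose 2))"
    unfolding distrib_left right_diff_distrib two_times_choose_2 by (simp add: algebra_simps)
  finally show ?thesis by simp
qed

text \<open>This is the usual theorem divided by \<open>qpoch q q N\<close>, so no Gaussian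
  binomials occur. The induction lets \<open>x\<close> vary because each step replaces
  \<open>x\<close> by \<open>x * q\<close>: multiplying by \<open>1 - q ^ Suc N\<close> gives two
  sums of length \<open>N\<close>, both at \<open>x * q\<close>, with weights 1 and
  \<open>x\<close>. Then \<open>1 + x\<close> is the first factor of the longer product.\<close>

lemma q_binomial_theorem:
  assumes "norm q < 1"
  shows "(\<Sum>j\<le>N. x ^ j * q ^ (j choose 2) / (qpoch q q (N - j) * qpoch q q j))
    = qpoch (- x) q N / qpoch q q N"
proof (induction N arbitrary: x)
  case (Suc N)
  define t where "t N x j = x ^ j * q ^ (j choose 2) / (qpoch q q (N - j) * qpoch q q j)" for N x j
  note nz = qpoch_q_nonzero[OF assms]
  have factor_nz: "1 - q ^ Suc k \<noteq> 0" for k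
    using nz[of "Suc k"] by (simp add: qpoch_Suc)
  \<comment> \<open>The factor \<open>1 - q ^ (Suc N - j)\<close> cancels the last factor of
    \<open>qpoch q q (Suc N - j)\<close>, and \<open>q ^ j\<close> rescales \<open>x\<close> to
    \<open>x * q\<close>.\<close>
  have left: "q ^ j * (1 - q ^ (Suc N - j)) * t (Suc N) x j = t N (x * q) j" if "j \<le> N" for j
  proof -
    have "Suc N - j = Suc (N - j)" using that by simp
    then show ?thesis
      using nz factor_nz[of "N - j"] by (simp add: t_def qpoch_Suc power_mult_distrib field_simps)
  qed
  \<comment> \<open>Here the last factor of \<open>qpoch q q (Suc j)\<close> cancels. The rescaling
    by \<open>q ^ j\<close> now comes from the growth of the binomial exponent.\<close>
  have right: "(1 - q ^ Suc j) * t (Suc N) x (Suc j) = x * t N (x * q) j" for j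
    using nz factor_nz[of j]
    by (simp add: t_def qpoch_Suc Suc_choose_2 power_mult_distrib power_add field_simps)
  have split: "(1 - q ^ Suc N) * t (Suc N) x j
      = q ^ j * (1 - q ^ (Suc N - j)) * t (Suc N) x j + (1 - q ^ j) * t (Suc N) x j"
    if "j \<le> Suc N" for j
  proof -
    have "q ^ Suc N = q ^ j * q ^ (Suc N - j)" using that by (simp flip: power_add)
    then show ?thesis by (simp add: algebra_simps)
  qed
  have "(1 - q ^ Suc N) * (\<Sum>j\<le>Suc N. t (Suc N) x j)
      = (\<Sum>j\<le>Suc N. q ^ j * (1 - q ^ (Suc N - j)) * t (Suc N) x j)
        + (\<Sum>j\<le>Suc N. (1 - q ^ j) * t (Suc N) x j)"
    unfolding sum_distrib_left sum.distrib[symmetric] by (intro sum.cong refl split) simp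
  \<comment> \<open>The term \<open>j = Suc N\<close> vanishes here; in the second sum the term
    \<open>j = 0\<close> vanishes, which permits the index shift.\<close>
  also have "(\<Sum>j\<le>Suc N. q ^ j * (1 - q ^ (Suc N - j)) * t (Suc N) x j) = (\<Sum>j\<le>N. t N (x * q) j)"
    unfolding sum.atMost_Suc using left by simp
  also have "(\<Sum>j\<le>Suc N. (1 - q ^ j) * t (Suc N) x j) = (\<Sum>j\<le>N. x * t N (x * q) j)"
    unfolding sum.atMost_Suc_shift right by simp
  also have "(\<Sum>j\<le>N. t N (x * q) j) + (\<Sum>j\<le>N. x * t N (x * q) j)
      = (1 + x) * (\<Sum>j\<le>N. t N (x * q) j)"
    by (simp add: distrib_right flip: sum_distrib_left)
  also have "\<dots> = (1 + x) * (qpoch (- (x * q)) q N / qpoch q q N)"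
    unfolding t_def Suc.IH ..
  also have "\<dots> = qpoch (- x) q (Suc N) / qpoch q q N"
    by (simp add: qpoch_Suc_left)
  finally have "(\<Sum>j\<le>Suc N. t (Suc N) x j) = qpoch (- x) q (Suc N) / qpoch q q N / (1 - q ^ Suc N)"
    using factor_nz[of N] by (metis nonzero_mult_div_cancel_left)
  also have "\<dots> = qpoch (- x) q (Suc N) / qpoch q q (Suc N)"
    by (simp add: qpoch_Suc)
  finally show ?case by (simp only: t_def)
qed (simp add: binomial_eq_0)

text \<open>The product on the left consists of the factors \<open>1 + 1 / (z * q ^ i)\<close> for i
  from r down to 1. Multiplying each by \<open>z * q ^ i\<close> gives \<open>1 + z * q ^ i\<close>,
  and these multipliers together form the prefactor.\<close>

lemma qpoch_reverse:
  assumes "q \<noteq> 0" "z \<noteq> 0"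
  shows "z ^ r * q ^ (Suc r choose 2) * qpoch (- (1 / (z * q ^ r))) q r = qpoch (- (z * q)) q r"
proof (induction r)
  case (Suc r)
  have "qpoch (- (1 / (z * q ^ Suc r))) q (Suc r)
      = (1 + 1 / (z * q ^ Suc r)) * qpoch (- (1 / (z * q ^ r))) q r"
    using assms by (simp add: qpoch_Suc_left)
  then have "z ^ Suc r * q ^ (Suc (Suc r) choose 2) * qpoch (- (1 / (z * q ^ Suc r))) q (Suc r)
      = (z * q ^ Suc r * (1 + 1 / (z * q ^ Suc r)))
        * (z ^ r * q ^ (Suc r choose 2) * qpoch (- (1 / (z * q ^ r))) q r)"
    by (simp add: Suc_choose_2[of "Suc r"] power_add ac_simps)
  also have "z * q ^ Suc r * (1 + 1 / (z * q ^ Suc r)) = 1 + z * q ^ Suc r"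
    using assms by (simp add: field_simps)
  also have "(1 + z * q ^ Suc r) * (z ^ r * q ^ (Suc r choose 2) * qpoch (- (1 / (z * q ^ r))) q r)
      = qpoch (- (z * q)) q (Suc r)"
    unfolding Suc.IH by (simp add: qpoch_Suc ac_simps)
  finally show ?case .
qed (simp add: Suc_choose_2 binomial_eq_0)

lemma qpoch_difference:
  fixes n :: nat
  assumes "q \<noteq> 0" "z \<noteq> 0"
  defines "y \<equiv> 1 / (z * q ^ Suc n)"
  shows "z ^ Suc n * q ^ (Suc (Suc n) choose 2)
      * (qpoch (- y) q (2 * n + 1) - qpoch (- (y * q ^ 2)) q (2 * n + 1) / q ^ (2 * n + 1))
    = (1 - z) * (1 - q ^ (2 * n + 1)) * qpoch (- z) q n * qpoch (- (1 / z)) q n"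
proof (cases n)
  \<comment> \<open>With a single factor in each product there is no common part, so this case is
    computed directly.\<close>
  case 0
  then show ?thesis
    using assms by (simp add: y_def qpoch_Suc Suc_choose_2 binomial_eq_0 field_simps power2_eq_square)
next
  case (Suc r)
  \<comment> \<open>The common factors start at \<open>1 + a\<close>: the product at
    \<open>y\<close> has two more below them, the product at \<open>y * q ^ 2\<close> two more
    above.\<close>
  define a where "a = 1 / (z * q ^ r)"
  have y: "y * q ^ 2 = a" "y = a / q ^ 2"
    using assms(1,2) by (simp_all add: y_def a_def Suc power2_eq_square ac_simps)
  have N: "2 * n + 1 = Suc (Suc (2 * r + 1))" using Suc by simp
  define P where "P = qpoch (- a) q (2 * r + 1)"
  have low: "qpoch (- y) q (2 * n + 1) = (1 + y) * (1 + y * q) * P"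
    unfolding N P_def y(1)[symmetric] by (simp add: qpoch_Suc_left power2_eq_square mult.assoc)
  have high: "qpoch (- (y * q ^ 2)) q (2 * n + 1)
      = P * (1 + a * q ^ (2 * r + 1)) * (1 + a * q ^ (2 * r + 2))"
    unfolding N P_def y(1) by (simp add: qpoch_Suc)
  \<comment> \<open>After division by \<open>q ^ (2 * r + 3)\<close> the terms linear in
    \<open>1 / z\<close> agree and cancel; the other four factorise. Treating \<open>q ^ r\<close>
    as an independent nonzero \<open>Q\<close> makes this an identity of rational functions.\<close>
  have factors: "z ^ 2 * q ^ (2 * r + 3) * ((1 + y) * (1 + y * q)
        - (1 + a * q ^ (2 * r + 1)) * (1 + a * q ^ (2 * r + 2)) / q ^ (2 * r + 3))
      = (1 - z ^ 2) * (1 - q ^ (2 * r + 3))"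
  proof -
    define Q where "Q = q ^ r"
    have Q: "Q \<noteq> 0" using assms(1) by (simp add: Q_def)
    have pw: "q ^ (2 * r + 1) = Q ^ 2 * q" "q ^ (2 * r + 2) = Q ^ 2 * q ^ 2"
      "q ^ (2 * r + 3) = Q ^ 2 * q ^ 3"
      unfolding Q_def power_add power_even_eq by simp_all
    show ?thesis
      unfolding pw y(2) a_def Q_def[symmetric] using assms(1,2) Q
      by (simp add: field_simps power2_eq_square power3_eq_cube)
  qed
  \<comment> \<open>The first \<open>r\<close> factors contain negative powers of \<open>q\<close>
    and are reversed; the remaining \<open>Suc r = n\<close> factors start at
    \<open>1 + 1 / z\<close>.\<close>
  have "P = qpoch (- a) q (r + Suc r)" by (simp add: P_def mult_2)
  also have "\<dots> = qpoch (- a) q r * qpoch (- (1 / z)) q n"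
    unfolding qpoch_add using assms(1,2) by (simp add: a_def Suc)
  finally have "z ^ r * q ^ (Suc r choose 2) * P = qpoch (- (z * q)) q r * qpoch (- (1 / z)) q n"
    using qpoch_reverse[OF assms(1,2), of r] by (simp add: a_def mult.assoc)
  \<comment> \<open>The factor \<open>1 + z\<close> of \<open>1 - z ^ 2\<close> supplies the missing
    first factor of \<open>qpoch (- z) q n\<close>; \<open>1 - z\<close> is left over.\<close>
  then have P: "(1 + z) * (z ^ r * q ^ (Suc r choose 2) * P) = qpoch (- z) q n * qpoch (- (1 / z)) q n"
    by (simp add: Suc qpoch_Suc_left)
  \<comment> \<open>One part of the prefactor pays for the reversal, the other clears denominators
    in \<open>factors\<close>.\<close>
  have pw: "z ^ Suc n * q ^ (Suc (Suc n) choose 2)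
      = (z ^ r * q ^ (Suc r choose 2)) * (z ^ 2 * q ^ (2 * r + 3))"
  proof -
    have "Suc (Suc n) choose 2 = (Suc r choose 2) + (2 * r + 3)"
      by (simp add: Suc Suc_choose_2)
    then show ?thesis by (simp add: Suc power_add power2_eq_square)
  qed
  have "z ^ Suc n * q ^ (Suc (Suc n) choose 2)
      * (qpoch (- y) q (2 * n + 1) - qpoch (- (y * q ^ 2)) q (2 * n + 1) / q ^ (2 * n + 1))
    = z ^ r * q ^ (Suc r choose 2) * P * (z ^ 2 * q ^ (2 * r + 3) * ((1 + y) * (1 + y * q)
        - (1 + a * q ^ (2 * r + 1)) * (1 + a * q ^ (2 * r + 2)) / q ^ (2 * r + 3)))"
  proof -
    have "2 * n + 1 = 2 * r + 3" using Suc by simp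
    then have e: "q ^ (2 * n + 1) = q ^ (2 * r + 3)" by (rule arg_cong)
    show ?thesis unfolding low high pw e
      by (simp only: right_diff_distrib times_divide_eq_right ac_simps)
  qed
  also have "\<dots> = (1 - z) * (1 - q ^ (2 * r + 3)) * ((1 + z) * (z ^ r * q ^ (Suc r choose 2) * P))"
    unfolding factors by (simp add: power2_eq_square algebra_simps)
  also have "2 * r + 3 = 2 * n + 1" using Suc by simp
  finally show ?thesis unfolding P by (simp only: mult.assoc)
qed

lemma powi_diff_of_nat: "x \<noteq> 0 \<Longrightarrow> x powi (int m - int n) = x ^ m / x ^ n"
  for x :: "'a :: field"
  by (simp add: power_int_diff)

text \<open>The cross term of \<open>binom2_diff\<close> joins \<open>1 / z ^ j\<close> to give the
  \<open>j\<close>-th power of \<open>1 / (z * q ^ m)\<close>, so the right side is a constant times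
  a numerator of the q-binomial sum.\<close>

lemma powi_binom2_diff:
  fixes q z :: complex
  assumes "q \<noteq> 0" "z \<noteq> 0"
  shows "z powi (- (int j - int m)) * q powi binom2 (int j - int m)
    = z ^ m * q ^ (Suc m choose 2) * ((1 / (z * q ^ m)) ^ j * q ^ (j choose 2))"
proof -
  have "z powi (- (int j - int m)) = z ^ m / z ^ j"
    using assms powi_diff_of_nat[of z m j] by simp
  moreover have "q powi binom2 (int j - int m) = q ^ (j choose 2) * q ^ (Suc m choose 2) / (q ^ m) ^ j"
  proof -
    have "binom2 (int j - int m) = int ((j choose 2) + (Suc m choose 2)) - int (m * j)"
      by (simp add: binom2_diff)
    then show ?thesis
      using powi_diff_of_nat[OF assms(1), of "(j choose 2) + (Suc m choose 2)" "m * j"]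
      by (simp only: power_add power_mult)
  qed
  ultimately show ?thesis by (simp add: power_divide power_mult_distrib)
qed

theorem lemma3p5:
  fixes q z :: complex
  assumes "0 < norm q" and "norm q < 1"
    and "0 < norm z" and "norm z < 1"
  shows "asym_bilateral_bailey_pair q
    (\<lambda>n::int. z powi (- n) * q powi (binom2 n) * (1 - q powi (2 * n + 1)) / (1 - z))
    (\<lambda>n::nat. qpoch (- z) q n * qpoch (- (1 / z)) q n / qpoch q q (2 * n))"
  unfolding asym_bilateral_bailey_pair_def
proof
  fix n :: nat
  define N where "N = 2 * n + 1"
  define y where "y = 1 / (z * q ^ Suc n)"
  \<comment> \<open>\<open>C\<close> collects what does not depend on \<open>j\<close>; it is also
    the prefactor in \<open>qpoch_difference\<close>.\<close>
  define C where "C = z ^ Suc n * q ^ (Suc (Suc n) choose 2)"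
  define D where "D j = qpoch q q (N - j) * qpoch q q j" for j
  have nz: "q \<noteq> 0" "z \<noteq> 0" "1 - z \<noteq> 0" using assms by auto
  have last: "1 - q ^ N \<noteq> 0"
    using qpoch_q_nonzero[OF assms(2), of N] by (simp add: N_def qpoch_Suc)
  define f where "f k = z powi (- k) * q powi (binom2 k) * (1 - q powi (2 * k + 1)) / (1 - z)
      / (qpoch q q (nat (int n - k)) * qpoch q q (nat (int n + k + 1)))" for k
  have "(\<Sum>k = - int n - 1..int n. f k) = (\<Sum>j\<le>N. f (int j - int (Suc n)))"
    by (rule sum.reindex_bij_witness[where i = "\<lambda>j. int j - int (Suc n)"
        and j = "\<lambda>k. nat (k + int (Suc n))"]) (auto simp: N_def)
  also have "\<dots> = (\<Sum>j\<le>N. C / (1 - z) * (y ^ j * q ^ (j choose 2) / D j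
      - (y * q ^ 2) ^ j * q ^ (j choose 2) / D j / q ^ N))"
  proof (rule sum.cong)
    fix j assume "j \<in> {..N}"
    then have "nat (int n - (int j - int (Suc n))) = N - j" "nat (int n + (int j - int (Suc n)) + 1) = j"
      by (auto simp: N_def)
    \<comment> \<open>For \<open>k = j - Suc n\<close> the exponent \<open>2 * k + 1\<close> is
      \<open>2 * j - N\<close>; the factor \<open>(q ^ 2) ^ j\<close> is what moves the second sum
      from \<open>y\<close> to \<open>y * q ^ 2\<close>.\<close>
    moreover have "q powi (2 * (int j - int (Suc n)) + 1) = (q ^ 2) ^ j / q ^ N"
    proof -
      have "2 * (int j - int (Suc n)) + 1 = int (2 * j) - int N" by (simp add: N_def)
      then show ?thesis using powi_diff_of_nat[OF nz(1), of "2 * j" N] by (simp only: power_mult)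
    qed
    ultimately have "f (int j - int (Suc n))
        = C * (y ^ j * q ^ (j choose 2)) * (1 - (q ^ 2) ^ j / q ^ N) / (1 - z) / D j"
      unfolding f_def powi_binom2_diff[OF nz(1,2)] by (simp only: C_def y_def D_def)
    also have "\<dots> = C / (1 - z) * (y ^ j * q ^ (j choose 2) / D j
      - (y * q ^ 2) ^ j * q ^ (j choose 2) / D j / q ^ N)"
      by (simp add: power_mult_distrib diff_divide_distrib right_diff_distrib ac_simps)
    finally show "f (int j - int (Suc n)) = C / (1 - z) * (y ^ j * q ^ (j choose 2) / D j
      - (y * q ^ 2) ^ j * q ^ (j choose 2) / D j / q ^ N)" .
  qed simp
  also have "\<dots> = C / (1 - z) * (qpoch (- y) q N / qpoch q q N
      - qpoch (- (y * q ^ 2)) q N / qpoch q q N / q ^ N)"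
    unfolding sum_distrib_left[symmetric] sum_subtractf sum_divide_distrib[symmetric] D_def
      q_binomial_theorem[OF assms(2)] ..
  also have "\<dots> = C * (qpoch (- y) q N - qpoch (- (y * q ^ 2)) q N / q ^ N) / ((1 - z) * qpoch q q N)"
    by (simp add: diff_divide_distrib right_diff_distrib ac_simps)
  also have "\<dots> = (1 - z) * (1 - q ^ N) * qpoch (- z) q n * qpoch (- (1 / z)) q n / ((1 - z) * qpoch q q N)"
    using qpoch_difference[OF nz(1,2), of n] by (simp only: C_def y_def N_def)
  \<comment> \<open>The surplus \<open>1 - q ^ N\<close> is the last factor of
    \<open>qpoch q q N\<close>, so cancelling it leaves the denominator
    \<open>qpoch q q (2 * n)\<close>; the surplus \<open>1 - z\<close> cancels the one in
    \<open>\<alpha>\<close>.\<close>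
  also have "qpoch q q N = qpoch q q (2 * n) * (1 - q ^ N)"
    by (simp add: N_def qpoch_Suc)
  also have "(1 - z) * (1 - q ^ N) * qpoch (- z) q n * qpoch (- (1 / z)) q n
      / ((1 - z) * (qpoch q q (2 * n) * (1 - q ^ N)))
      = qpoch (- z) q n * qpoch (- (1 / z)) q n / qpoch q q (2 * n)"
    using nz last by simp
  finally show "qpoch (- z) q n * qpoch (- (1 / z)) q n / qpoch q q (2 * n)
    = (\<Sum>k = - int n - 1..int n. z powi (- k) * q powi (binom2 k) * (1 - q powi (2 * k + 1)) / (1 - z)
      / (qpoch q q (nat (int n - k)) * qpoch q q (nat (int n + k + 1))))"
    by (simp only: f_def)
qed

end
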